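(* The critical cardinalities of the properties $\mathsf{S}_{fin}(\mathcal{B}_\Gamma,\mathcal{B}_{\mathrm T})$, $\mathsf{S}_{fin}(\Gamma,\mathrm{T})$ and $\mathsf{S}_{fin}(C_\Gamma,C_{\mathrm T})$ are all equal to $\mathfrak{b}$; that is, $\mathsf{non}(\mathsf{S}_{fin}(\mathcal{B}_\Gamma,\mathcal{B}_{\mathrm T}))=\mathsf{non}(\mathsf{S}_{fin}(\Gamma,\mathrm{T}))=\mathsf{non}(\mathsf{S}_{fin}(C_\Gamma,C_{\mathrm T}))=\mathfrak{b}$.
   Context: A "set of reals" is an infinite, zero-dimensional, separable metrizable topological space $X$. A cover of $X$ is a family $\mathcal{U}$ of subsets of $X$ with $X\notin\mathcal{U}$ and $X=\bigcup\mathcal{U}$. All covers considered are countable. A cover $\mathcal{U}$ is large if $\{U\in\mathcal{U}: x\in U\}$ is infinite for every $x\in X$. It is a $\tau$-cover if it is large and for all $x,y\in X$ either $\{U\in\mathcal{U}: x\in U, y\notin U\}$ is finite or $\{U\in\mathcal{U}: y\in U, x\notin U\}$ is finite. It is a $\gamma$-cover if $\mathcal{U}$ is infinite and $\{U\in\mathcal{U}: x\notin U\}$ is finite for every $x\in X$. $\Gamma,\mathrm{T}$ denote the collections of countable open $\gamma$-covers and $\tau$-covers of $X$; $\mathcal{B}_\Gamma,\mathcal{B}_{\mathrm T}$ the analogous collections of countable covers by Borel sets; $C_\Gamma,C_{\mathrm T}$ the analogous collections of countable covers by clopen sets. $\mathsf{S}_{fin}(\mathscr{A},\mathscr{B})$: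 for each sequence $\langle\mathcal{U}_n:n\in\mathbb{N}\rangle$ of members of $\mathscr{A}$ there are finite (possibly empty) $\mathcal{F}_n\subseteq\mathcal{U}_n$, $n\in\mathbb{N}$, such that $\bigcup_{n}\mathcal{F}_n\in\mathscr{B}$. For a property $P$ of sets of reals, its critical cardinality $\mathsf{non}(P)$ is the minimal cardinality of a set of reals not satisfying $P$. $\mathfrak{b}$ is the minimal cardinality of a subset of $\mathbb{N}^{\mathbb{N}}$ that is unbounded with respect to eventual domination $\leq^*$. *)

theory Defs
  imports "HOL-Analysis.Analysis"
begin

unbundle cardinal_syntax

section \<open>Sets of reals\<close>

definition zero_dimensional_space :: "'a topology \<Rightarrow> bool" where
  "zero_dimensional_space X \<longleftrightarrow>
     (\<forall>U x. openin X U \<and> x \<in> U \<longrightarrow> (\<exists>V. openin X V \<and> closedin X V \<and> x \<in> V \<and> V \<subseteq> U))"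

text \<open>
  Following the convention of the literature on selection principles, a ``set of reals'' is any
  space of the following kind; its carrier need not literally consist of real numbers.
\<close>

definition set_of_reals :: "'a topology \<Rightarrow> bool" where
  "set_of_reals X \<longleftrightarrow>
     infinite (topspace X) \<and> zero_dimensional_space X \<and> separable_space X \<and> metrizable_space X"


section \<open>Covers\<close>

definition cover_of :: "'a topology \<Rightarrow> 'a set set \<Rightarrow> bool" where
  "cover_of X \<U> \<longleftrightarrow> \<U> \<subseteq> Pow (topspace X) \<and> topspace X \<notin> \<U> \<and> \<Union>\<U> = topspace X"

definition large_cover_of :: "'a topology \<Rightarrow> 'a set set \<Rightarrow> bool" where
  "large_cover_of X \<U> \<longleftrightarrow> cover_of X \<U> \<and> (\<forall>x\<in>topspace X. infinite {U \<in> \<U>. x \<in> U})"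

definition tau_cover_of :: "'a topology \<Rightarrow> 'a set set \<Rightarrow> bool" where
  "tau_cover_of X \<U> \<longleftrightarrow> large_cover_of X \<U> \<and>
     (\<forall>x\<in>topspace X. \<forall>y\<in>topspace X.
        finite {U \<in> \<U>. x \<in> U \<and> y \<notin> U} \<or> finite {U \<in> \<U>. y \<in> U \<and> x \<notin> U})"

definition gamma_cover_of :: "'a topology \<Rightarrow> 'a set set \<Rightarrow> bool" where
  "gamma_cover_of X \<U> \<longleftrightarrow> cover_of X \<U> \<and> infinite \<U> \<and>
     (\<forall>x\<in>topspace X. finite {U \<in> \<U>. x \<notin> U})"

definition open_sets :: "'a topology \<Rightarrow> 'a set set" where
  "open_sets X = {U. openin X U}"

definition clopen_sets :: "'a topology \<Rightarrow> 'a set set" where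
  "clopen_sets X = {U. openin X U \<and> closedin X U}"

definition borel_sets :: "'a topology \<Rightarrow> 'a set set" where
  "borel_sets X = sigma_sets (topspace X) {U. openin X U}"

text \<open>
  The second argument \<open>\<S>\<close> is the class of admissible members: open, Borel or clopen sets.
\<close>

definition gamma_covers :: "'a topology \<Rightarrow> 'a set set \<Rightarrow> 'a set set set" where
  "gamma_covers X \<S> = {\<U>. countable \<U> \<and> \<U> \<subseteq> \<S> \<and> gamma_cover_of X \<U>}"

definition tau_covers :: "'a topology \<Rightarrow> 'a set set \<Rightarrow> 'a set set set" where
  "tau_covers X \<S> = {\<U>. countable \<U> \<and> \<U> \<subseteq> \<S> \<and> tau_cover_of X \<U>}"


section \<open>The selection principle\<close>

definition S_fin :: "'a set set set \<Rightarrow> 'a set set set \<Rightarrow> bool" where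
  "S_fin \<A> \<B> \<longleftrightarrow>
     (\<forall>\<U> :: nat \<Rightarrow> 'a set set. (\<forall>n. \<U> n \<in> \<A>) \<longrightarrow>
        (\<exists>\<F> :: nat \<Rightarrow> 'a set set. (\<forall>n. finite (\<F> n) \<and> \<F> n \<subseteq> \<U> n) \<and> (\<Union>n. \<F> n) \<in> \<B>))"


section \<open>Critical cardinalities and the bounding number\<close>

definition is_least_card :: "'a set set \<Rightarrow> 'b rel \<Rightarrow> bool" where
  "is_least_card \<C> \<kappa> \<longleftrightarrow> (\<exists>A\<in>\<C>. |A| =o \<kappa>) \<and> (\<forall>A\<in>\<C>. \<kappa> \<le>o |A| )"

text \<open>
  \<open>non_eq P \<kappa>\<close> expresses that the critical cardinality of \<open>P\<close>, computed among the spaces whose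
  points are taken from the type \<open>'a\<close>, exists and is equal to \<open>\<kappa>\<close>. A separable metrizable space
  has at most continuum many points, so every type containing a copy of the reals carries a
  homeomorphic copy of every set of reals, and the minimum does not depend on the choice of
  such a type.
\<close>

definition non_eq :: "('a topology \<Rightarrow> bool) \<Rightarrow> 'b rel \<Rightarrow> bool" where
  "non_eq P \<kappa> \<longleftrightarrow> is_least_card {topspace X | X. set_of_reals X \<and> \<not> P X} \<kappa>"

definition eventually_dominated :: "(nat \<Rightarrow> nat) \<Rightarrow> (nat \<Rightarrow> nat) \<Rightarrow> bool" (infix "\<le>\<^sup>*" 50) where
  "f \<le>\<^sup>* g \<longleftrightarrow> (\<forall>\<^sub>F n in sequentially. f n \<le> g n)"

definition unbounded_family :: "(nat \<Rightarrow> nat) set \<Rightarrow> bool" where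
  "unbounded_family F \<longleftrightarrow> (\<nexists>g. \<forall>f\<in>F. f \<le>\<^sup>* g)"

definition bounding_number :: "(nat \<Rightarrow> nat) rel" ("\<bb>") where
  "\<bb> = |SOME F. unbounded_family F \<and> (\<forall>G. unbounded_family G \<longrightarrow> |F| \<le>o |G| )|"

lemma unbounded_family_UNIV: "unbounded_family UNIV"
  unfolding unbounded_family_def
proof
  assume "\<exists>g. \<forall>f\<in>UNIV. f \<le>\<^sup>* g"
  then obtain g where "(\<lambda>n. Suc (g n)) \<le>\<^sup>* g"
    by blast
  then show False
    by (simp add: eventually_dominated_def)
qed

lemma is_least_card_bounding_number: "is_least_card {F. unbounded_family F} \<bb>"
proof -
  let ?R = "card_of ` {F. unbounded_family F}"
  have "?R \<noteq> {}"
    using unbounded_family_UNIV by blast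
  moreover have "\<forall>r\<in>?R. Card_order r"
    by (auto intro: card_of_Card_order)
  ultimately have "\<exists>r\<in>?R. \<forall>r'\<in>?R. r \<le>o r'"
    by (rule exists_minim_Card_order)
  then have "\<exists>F. unbounded_family F \<and> (\<forall>G. unbounded_family G \<longrightarrow> |F| \<le>o |G| )"
    by auto
  from someI_ex[OF this] show ?thesis
    unfolding is_least_card_def bounding_number_def
    by (auto intro: card_of_refl)
qed

end

theory Submission
  imports Defs
begin

text \<open>
  If \<open>X\<close> has fewer than \<open>\<bb>\<close> points, then some \<open>g\<close> dominates all functions
  \<open>n \<mapsto> min {m. x lies in all members of the n-th cover with index at least m}\<close>, and selecting the
  members with index between \<open>g n\<close> and \<open>g n + n\<close> gives even a gamma-cover.

  Conversely, let \<open>F\<close> be an unbounded family of monotone functions with \<open>|F| = \<bb>\<close>. The points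
  of the counterexample are the arrays \<open>[f n \<le> m]\<close> and \<open>[m < f n \<or> g n \<le> m]\<close> for \<open>f, g \<in> F\<close>, together
  with countably many arrays that make the sets \<open>V n m\<close> of the arrays with value 1 at \<open>(n, m)\<close>
  distinct. Given a large selection, let \<open>h n\<close> be the largest index selected from row \<open>n\<close>. As \<open>F\<close>
  stays unbounded on every infinite set of rows, there are \<open>f\<close> with \<open>h n < f n\<close> for infinitely many
  rows and then \<open>g\<close> with \<open>f n \<le> h n < g n\<close> for infinitely many rows, and the arrays
  \<open>[f n \<le> m]\<close> and \<open>[m < f n \<or> g n \<le> m]\<close> violate the tau-condition.
\<close>

section \<open>Lower bound: spaces with fewer than \<open>\<bb>\<close> points\<close>

lemma gamma_cover_imp_tau_cover:
  assumes "gamma_cover_of X \<U>"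
  shows "tau_cover_of X \<U>"
proof -
  have inf: "infinite \<U>" and fin: "finite {U \<in> \<U>. x \<notin> U}" if "x \<in> topspace X" for x
    using assms that by (auto simp: gamma_cover_of_def)
  have "infinite {U \<in> \<U>. x \<in> U}" if "x \<in> topspace X" for x
  proof
    assume "finite {U \<in> \<U>. x \<in> U}"
    moreover have "\<U> = {U \<in> \<U>. x \<in> U} \<union> {U \<in> \<U>. x \<notin> U}" by auto
    ultimately show False
      using inf[OF that] fin[OF that] by (metis finite_UnI)
  qed
  moreover have "finite {U \<in> \<U>. x \<in> U \<and> y \<notin> U}" if "y \<in> topspace X" for x y
    by (rule finite_subset[OF _ fin[OF that]]) auto
  ultimately show ?thesis
    using assms unfolding tau_cover_of_def large_cover_of_def gamma_cover_of_def by blast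
qed

text \<open>A point can be missed only by members selected from the finitely many rows before
  \<open>g\<close> starts to work for it. Taking \<open>n + 1\<close> members from row
  \<open>n\<close> keeps the union infinite even if different covers share members.\<close>

lemma gamma_cover_of_selection:
  assumes U: "\<And>n. gamma_cover_of X (\<U> n)"
    and en: "\<And>n. bij_betw (en n) (UNIV :: nat set) (\<U> n)"
    and g: "\<And>x. x \<in> topspace X \<Longrightarrow> \<forall>\<^sub>F n in sequentially. \<forall>k\<ge>g n. x \<in> en n k"
  shows "gamma_cover_of X (\<Union>n. en n ` {g n..g n + n})" (is "gamma_cover_of X ?W")
proof -
  have memb: "en n k \<in> \<U> n" for n k
    using en by (auto simp: bij_betw_def)
  then have sub: "en n k \<subseteq> topspace X" "en n k \<noteq> topspace X" for n k
    using U[of n] by (fastforce simp: gamma_cover_of_def cover_of_def)+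
  have inf: "infinite ?W"
  proof
    assume fin: "finite ?W"
    \<comment> \<open>Row \<open>n\<close> alone supplies \<open>n + 1\<close> distinct members;
      taking \<open>n = card ?W\<close> exceeds the supposed size.\<close>
    have "card (en (card ?W) ` {g (card ?W)..g (card ?W) + card ?W}) = Suc (card ?W)"
      using en[of "card ?W"] by (subst card_image) (auto simp: bij_betw_def intro: inj_on_subset)
    moreover have "card (en (card ?W) ` {g (card ?W)..g (card ?W) + card ?W}) \<le> card ?W"
      by (rule card_mono[OF fin]) blast
    ultimately show False by simp
  qed
  have fin: "finite {V \<in> ?W. x \<notin> V}" if x: "x \<in> topspace X" for x
  proof -
    obtain N where N: "\<And>n k. n \<ge> N \<Longrightarrow> k \<ge> g n \<Longrightarrow> x \<in> en n k"
      using g[OF x] by (auto simp: eventually_sequentially)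
    have "{V \<in> ?W. x \<notin> V} \<subseteq> (\<Union>n<N. en n ` {g n..g n + n})"
    proof
      fix V assume "V \<in> {V \<in> ?W. x \<notin> V}"
      then obtain n k where "V = en n k" "k \<in> {g n..g n + n}" "x \<notin> en n k" by blast
      moreover from this have "n < N"
        using N[of n k] by (meson atLeastAtMost_iff not_le)
      ultimately show "V \<in> (\<Union>n<N. en n ` {g n..g n + n})" by blast
    qed
    then show ?thesis
      by (rule finite_subset) auto
  qed
  have "\<Union>?W = topspace X"
  proof
    show "topspace X \<subseteq> \<Union>?W"
    proof
      fix x assume x: "x \<in> topspace X"
      \<comment> \<open>Only finitely many members miss \<open>x\<close> and \<open>?W\<close> is
        infinite, so some member contains \<open>x\<close>.\<close>
      have "{V \<in> ?W. x \<notin> V} \<noteq> ?W"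
        using inf fin[OF x] by metis
      then show "x \<in> \<Union>?W" by blast
    qed
  qed (use sub in blast)
  moreover have "?W \<subseteq> Pow (topspace X)" "topspace X \<notin> ?W"
    using sub by blast+
  ultimately show ?thesis
    using inf fin by (simp add: gamma_cover_of_def cover_of_def)
qed

text \<open>Covers that admit no good selection turn the points into an unbounded family of
  functions, and such a family is an image of the carrier. The class \<S> is arbitrary, so clopen,
  open and Borel covers are treated at once.\<close>

lemma bounding_number_le_if_not_S_fin:
  assumes "\<not> S_fin (gamma_covers X \<S>) (tau_covers X \<S>)"
  shows "\<bb> \<le>o |topspace X|"
proof -
  obtain \<U> where U: "\<And>n :: nat. \<U> n \<in> gamma_covers X \<S>"
    and no: "\<And>\<F>. (\<And>n. finite (\<F> n) \<and> \<F> n \<subseteq> \<U> n) \<Longrightarrow> (\<Union>n. \<F> n) \<notin> tau_covers X \<S>"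
    using assms unfolding S_fin_def by blast
  define en where "en n = from_nat_into (\<U> n)" for n
  have g: "gamma_cover_of X (\<U> n)" and c: "countable (\<U> n)" and s: "\<U> n \<subseteq> \<S>" for n
    using U[of n] by (auto simp: gamma_covers_def)
  then have en: "bij_betw (en n) UNIV (\<U> n)" for n
    unfolding en_def by (intro bij_betw_from_nat_into) (auto simp: gamma_cover_of_def)
  have memb: "en n k \<in> \<U> n" for n k
    using en by (auto simp: bij_betw_def)
  \<comment> \<open>Only finitely many members of the cover miss \<open>x\<close>, and the
    enumeration is injective, so their indices are bounded.\<close>
  have "\<exists>m. \<forall>k\<ge>m. x \<in> en n k" if x: "x \<in> topspace X" for x n
  proof -
    have "finite {V \<in> \<U> n. x \<notin> V}"
      using g[of n] x by (auto simp: gamma_cover_of_def)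
    then have "finite (en n -` {V \<in> \<U> n. x \<notin> V})"
      using en[of n] by (intro finite_vimageI) (auto simp: bij_betw_def)
    then obtain m where "\<forall>k\<in>en n -` {V \<in> \<U> n. x \<notin> V}. k < m"
      using finite_nat_set_iff_bounded by blast
    then show ?thesis
      using memb by (intro exI[of _ m]) (auto simp: not_less[symmetric])
  qed
  then obtain f where f: "\<And>x n k. x \<in> topspace X \<Longrightarrow> k \<ge> f x n \<Longrightarrow> x \<in> en n k"
    by metis
  have "unbounded_family (f ` topspace X)"
    unfolding unbounded_family_def
  proof
    assume "\<exists>h. \<forall>f'\<in>f ` topspace X. f' \<le>\<^sup>* h"
    then obtain h where h: "\<And>x. x \<in> topspace X \<Longrightarrow> f x \<le>\<^sup>* h" by blast
    have "\<forall>\<^sub>F n in sequentially. \<forall>k\<ge>h n. x \<in> en n k" if "x \<in> topspace X" for x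
      using h[OF that] f[OF that] unfolding eventually_dominated_def
      by (auto elim!: eventually_mono)
    from gamma_cover_imp_tau_cover[OF gamma_cover_of_selection[OF g en this]]
    have "(\<Union>n. en n ` {h n..h n + n}) \<in> tau_covers X \<S>"
      using memb s by (auto simp: tau_covers_def)
    then show False
      using no[of "\<lambda>n. en n ` {h n..h n + n}"] memb by blast
  qed
  then have "\<bb> \<le>o |f ` topspace X|"
    using is_least_card_bounding_number by (auto simp: is_least_card_def)
  then show ?thesis
    using card_of_image ordLeq_transitive by blast
qed

section \<open>Unbounded families of monotone functions\<close>

text \<open>Some \<open>f\<close> escapes \<open>h\<close> composed with the next-element function
  of \<open>D\<close>. Monotonicity carries each escape at \<open>k\<close> up to the next element
  of \<open>D\<close>.\<close>

lemma unbounded_family_on_infinite: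
  assumes F: "unbounded_family F" "\<And>f. f \<in> F \<Longrightarrow> mono f" and D: "infinite D"
  obtains f where "f \<in> F" "infinite {n \<in> D. h n < f n}"
proof -
  define nx where "nx k = (LEAST n. n \<in> D \<and> k \<le> n)" for k
  have nx: "nx k \<in> D" "k \<le> nx k" for k
  proof -
    have "\<exists>n. n \<in> D \<and> k \<le> n"
      using D by (meson infinite_nat_iff_unbounded_le)
    from LeastI_ex[OF this] show "nx k \<in> D" "k \<le> nx k"
      by (auto simp: nx_def)
  qed
  obtain f where f: "f \<in> F" "\<not> f \<le>\<^sup>* (\<lambda>k. h (nx k))"
    using F(1) unfolding unbounded_family_def by blast
  have "infinite {n \<in> D. h n < f n}"
  proof
    assume "finite {n \<in> D. h n < f n}"
    then obtain N where N: "\<And>n. n \<in> D \<Longrightarrow> h n < f n \<Longrightarrow> n < N"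
      using finite_nat_set_iff_bounded by auto
    have "f k \<le> h (nx k)" if "k \<ge> N" for k
    proof -
      have "f k \<le> f (nx k)"
        using F(2)[OF f(1)] nx(2) by (rule monoD)
      also have "\<dots> \<le> h (nx k)"
        using N[OF nx(1)[of k]] nx(2)[of k] that by force
      finally show ?thesis .
    qed
    then show False
      using f(2) by (auto simp: eventually_dominated_def eventually_sequentially)
  qed
  then show ?thesis
    using f(1) that by blast
qed

lemma infinite_unbounded_family:
  assumes "unbounded_family F"
  shows "infinite F"
proof
  assume "finite F"
  then have "f \<le>\<^sup>* (\<lambda>n. \<Sum>f\<in>F. f n)" if "f \<in> F" for f
    unfolding eventually_dominated_def
    using that by (intro always_eventually allI member_le_sum[of f F "\<lambda>f. f _"]) auto
  then show False
    using assms by (auto simp: unbounded_family_def)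
qed

text \<open>Partial sums are monotone and lie above the original function, so a bound for them would
  bound \<open>F\<close> as well.\<close>

lemma unbounded_family_mono:
  assumes "unbounded_family F"
  obtains G where "unbounded_family G" "\<And>f. f \<in> G \<Longrightarrow> mono f" "|G| \<le>o |F|"
proof
  let ?c = "\<lambda>f n. \<Sum>i\<le>n. f i :: nat"
  show "unbounded_family (?c ` F)"
    unfolding unbounded_family_def
  proof
    assume "\<exists>g. \<forall>f\<in>?c ` F. f \<le>\<^sup>* g"
    then obtain g where g: "\<And>f. f \<in> F \<Longrightarrow> ?c f \<le>\<^sup>* g" by blast
    have "f n \<le> ?c f n" for f :: "nat \<Rightarrow> nat" and n
      by (rule member_le_sum) auto
    then have "f \<le>\<^sup>* g" if "f \<in> F" for f
      using g[OF that] unfolding eventually_dominated_def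
      by (auto elim!: eventually_mono intro: order_trans)
    then show False
      using assms by (auto simp: unbounded_family_def)
  qed
  show "mono f" if "f \<in> ?c ` F" for f
    using that by (auto intro!: monoI sum_mono2)
  show "|?c ` F| \<le>o |F|"
    by (rule card_of_image)
qed

section \<open>Combinatorial core of the counterexample\<close>

text \<open>The array argument, detached from the topology. By \<open>dist\<close> a set
  \<open>V n m\<close> determines its row, so infinitely many rows yield infinitely many selected
  sets.\<close>

lemma not_S_fin_array:
  fixes V :: "nat \<Rightarrow> nat \<Rightarrow> 'a set"
  assumes F: "unbounded_family F" "\<And>f. f \<in> F \<Longrightarrow> mono f"
    and V: "\<And>n m. V n m \<in> \<S>" "\<And>n m. V n m \<subset> topspace X"
    and dist: "\<And>n m n' m'. V n m = V n' m' \<Longrightarrow> n = n' \<and> m = m'"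
    and fin: "\<And>x n. x \<in> topspace X \<Longrightarrow> finite {m. x \<notin> V n m}"
    and p: "\<And>f. f \<in> F \<Longrightarrow> p f \<in> topspace X \<and> (\<forall>n m. p f \<in> V n m \<longleftrightarrow> f n \<le> m)"
    and q: "\<And>f g. f \<in> F \<Longrightarrow> g \<in> F \<Longrightarrow>
              q f g \<in> topspace X \<and> (\<forall>n m. q f g \<in> V n m \<longleftrightarrow> m < f n \<or> g n \<le> m)"
  shows "\<not> S_fin (gamma_covers X \<S>) (tau_covers X \<S>)"
proof
  assume S: "S_fin (gamma_covers X \<S>) (tau_covers X \<S>)"
  define W where "W n = range (V n)" for n
  have "W n \<in> gamma_covers X \<S>" for n
  proof -
    have inj: "inj (V n)"
      using dist by (auto intro: injI)
    have inf: "infinite (W n)"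
      unfolding W_def using inj finite_imageD by blast
    have f: "finite {U \<in> W n. x \<notin> U}" if "x \<in> topspace X" for x
    proof -
      have "{U \<in> W n. x \<notin> U} = V n ` {m. x \<notin> V n m}"
        by (auto simp: W_def)
      then show ?thesis
        using fin[OF that] by simp
    qed
    have "topspace X \<subseteq> \<Union>(W n)"
    proof
      fix x assume x: "x \<in> topspace X"
      have "{U \<in> W n. x \<notin> U} \<noteq> W n"
        using inf f[OF x] by metis
      then show "x \<in> \<Union>(W n)" by blast
    qed
    then have "\<Union>(W n) = topspace X"
      using V(2) unfolding W_def by blast
    moreover have "W n \<subseteq> Pow (topspace X)" "topspace X \<notin> W n"
      using V(2) unfolding W_def by blast+
    ultimately show ?thesis
      using inf f V(1) unfolding gamma_covers_def gamma_cover_of_def cover_of_def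
      by (auto simp: W_def)
  qed
  then obtain H where H: "\<And>n. finite (H n)" "\<And>n. H n \<subseteq> W n" "(\<Union>n. H n) \<in> tau_covers X \<S>"
    using S unfolding S_fin_def by metis
  define K where "K n = {m. V n m \<in> H n}" for n
  have KH: "H n = V n ` K n" for n
    using H(2)[of n] by (auto simp: K_def W_def)
  have finK: "finite (K n)" for n
  proof -
    have "K n = V n -` H n" by (auto simp: K_def)
    moreover have "inj (V n)"
      using dist by (auto intro: injI)
    ultimately show ?thesis
      using finite_vimageI[OF H(1)] by metis
  qed
  \<comment> \<open>Rows may contribute nothing, and \<open>Max {}\<close> is unspecified; hence
    \<open>h\<close> is evaluated meaningfully only on the rows in \<open>D\<close>.\<close>
  define h where "h n = Max (K n)" for n
  define D where "D = {n. K n \<noteq> {}}"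
  have h: "h n \<in> K n" if "n \<in> D" for n
    using that finK Max_in by (auto simp: h_def D_def)
  have tau: "large_cover_of X (\<Union>n. H n)"
    "\<And>x y. x \<in> topspace X \<Longrightarrow> y \<in> topspace X \<Longrightarrow>
      finite {U \<in> \<Union>n. H n. x \<in> U \<and> y \<notin> U} \<or> finite {U \<in> \<Union>n. H n. y \<in> U \<and> x \<notin> U}"
    using H(3) unfolding tau_covers_def tau_cover_of_def by blast+
  \<comment> \<open>The point \<open>p f\<close> lies in a set selected from row \<open>n\<close>
    only if \<open>f n \<le> h n\<close>. Each row contributes finitely many sets, so largeness at
    \<open>p f\<close> requires infinitely many such rows.\<close>
  have large: "infinite {n \<in> D. f n \<le> h n}" if f: "f \<in> F" for f
  proof
    assume "finite {n \<in> D. f n \<le> h n}"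
    then have "finite (\<Union>n\<in>{n \<in> D. f n \<le> h n}. H n)"
      using H(1) by blast
    moreover have "{U \<in> \<Union>n. H n. p f \<in> U} \<subseteq> (\<Union>n\<in>{n \<in> D. f n \<le> h n}. H n)"
    proof
      fix U assume "U \<in> {U \<in> \<Union>n. H n. p f \<in> U}"
      then obtain n m where nm: "U = V n m" "m \<in> K n" "p f \<in> V n m"
        by (auto simp: KH)
      then have "f n \<le> m" "m \<le> h n" "n \<in> D"
        using p[OF f] finK[of n] by (auto simp: h_def D_def)
      then show "U \<in> (\<Union>n\<in>{n \<in> D. f n \<le> h n}. H n)"
        using nm KH by force
    qed
    ultimately have "finite {U \<in> \<Union>n. H n. p f \<in> U}"
      by (rule rev_finite_subset)
    then show False
      using tau(1) p[OF f] by (auto simp: large_cover_of_def)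
  qed
  have inf: "infinite {U \<in> \<Union>n. H n. x \<in> U \<and> y \<notin> U}"
    if E: "infinite E" "E \<subseteq> D" "\<And>n. n \<in> E \<Longrightarrow> x \<in> V n (h n) \<and> y \<notin> V n (h n)" for E x y
  proof
    assume "finite {U \<in> \<Union>n. H n. x \<in> U \<and> y \<notin> U}"
    moreover have "(\<lambda>n. V n (h n)) ` E \<subseteq> {U \<in> \<Union>n. H n. x \<in> U \<and> y \<notin> U}"
      using E(2,3) h by (fastforce simp: KH)
    ultimately have "finite ((\<lambda>n. V n (h n)) ` E)"
      by (rule rev_finite_subset)
    moreover have "inj_on (\<lambda>n. V n (h n)) E"
      using dist by (auto intro!: inj_onI)
    ultimately show False
      using E(1) finite_imageD by blast
  qed
  obtain f0 where "f0 \<in> F"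
    using infinite_unbounded_family[OF F(1)] by fastforce
  then have "infinite D"
    using large infinite_super[of "{n \<in> D. f0 n \<le> h n}" D] by auto
  \<comment> \<open>First escape \<open>h\<close> on all nonempty rows, then again on those rows
    where the \<open>f\<close> just found stays below \<open>h\<close>.\<close>
  from unbounded_family_on_infinite[OF F this, of h]
  obtain f where f: "f \<in> F" "infinite {n \<in> D. h n < f n}" by blast
  from unbounded_family_on_infinite[OF F large[OF f(1)], of h]
  obtain g where g: "g \<in> F" "infinite {n \<in> {n \<in> D. f n \<le> h n}. h n < g n}" by blast
  \<comment> \<open>Where \<open>f n \<le> h n < g n\<close>, the index \<open>h n\<close> lies in
    the gap of \<open>q f g\<close>.\<close>
  have "infinite {U \<in> \<Union>n. H n. p f \<in> U \<and> q f g \<notin> U}"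
    by (rule inf[OF g(2)]) (use p[OF f(1)] q[OF f(1) g(1)] in auto)
  moreover have "infinite {U \<in> \<Union>n. H n. q f g \<in> U \<and> p f \<notin> U}"
    by (rule inf[OF f(2)]) (use p[OF f(1)] q[OF f(1) g(1)] in auto)
  ultimately show False
    using tau(2) p[OF f(1)] q[OF f(1) g(1)] by blast
qed

section \<open>Sets of reals from injections into Baire space\<close>

text \<open>The map \<open>r\<close> is a homeomorphism onto a subspace of a countable power of the
  discrete naturals, and zero-dimensionality, second countability and metrizability pass to
  subspaces.\<close>

lemma set_of_reals_pullback:
  fixes r :: "'a \<Rightarrow> 'i::countable \<Rightarrow> nat"
  assumes inj: "inj_on r A" and inf: "infinite A"
  shows "set_of_reals (pullback_topology A r euclidean)" (is "set_of_reals ?X")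
proof -
  have top: "topspace ?X = A"
    by (simp add: topspace_pullback_topology)
  have open_r: "openin ?X {a \<in> A. r a \<in> U}" if "open U" for U
    using that by (auto simp: openin_pullback_topology)
  have "zero_dimensional_space ?X"
    unfolding zero_dimensional_space_def
  proof (intro allI impI, elim conjE)
    fix W x assume "openin ?X W" and x: "x \<in> W"
    then obtain U where U: "open U" "W = r -` U \<inter> A"
      by (auto simp: openin_pullback_topology)
    then have "openin (product_topology (\<lambda>i. euclidean) UNIV) U" "r x \<in> U"
      using x by (auto simp: open_fun_def)
    from product_topology_open_contains_basis[OF this]
    obtain B where B: "r x \<in> Pi\<^sub>E UNIV B" "finite {i. B i \<noteq> UNIV}" "Pi\<^sub>E UNIV B \<subseteq> U"
      by auto
    \<comment> \<open>Shrinking each of the finitely many restricted coordinates to the value at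
      \<open>x\<close> gives a cylinder, which is clopen.\<close>
    let ?C = "\<lambda>i. if B i = UNIV then UNIV else {r x i}"
    have "Pi\<^sub>E UNIV ?C = (\<Inter>i\<in>{i. B i \<noteq> UNIV}. {y. y i = r x i})"
      by (auto simp: PiE_def Pi_def extensional_def split: if_splits)
    moreover have "closed {y. y i = r x i}" for i
    proof -
      have "closed ((\<lambda>y :: 'i \<Rightarrow> nat. y i) -` {r x i})"
        by (rule closed_vimage) (auto intro: continuous_on_product_coordinates)
      then show ?thesis by (simp add: vimage_def)
    qed
    ultimately have cl: "closed (Pi\<^sub>E UNIV ?C)" by auto
    have op: "open (Pi\<^sub>E UNIV ?C)"
      by (rule open_PiE) (auto simp: open_discrete intro: finite_subset[OF _ B(2)])
    have "A - {a \<in> A. r a \<in> Pi\<^sub>E UNIV ?C} = {a \<in> A. r a \<in> - Pi\<^sub>E UNIV ?C}" by auto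
    then have "closedin ?X {a \<in> A. r a \<in> Pi\<^sub>E UNIV ?C}"
      using open_r[of "- Pi\<^sub>E UNIV ?C"] cl by (auto simp: closedin_def top)
    moreover have "Pi\<^sub>E UNIV ?C \<subseteq> Pi\<^sub>E UNIV B"
      using B(1) by (intro PiE_mono) (auto simp: PiE_iff)
    ultimately show "\<exists>V. openin ?X V \<and> closedin ?X V \<and> x \<in> V \<and> V \<subseteq> W"
      using open_r[OF op] x U(2) B(3)
      by (intro exI[of _ "{a \<in> A. r a \<in> Pi\<^sub>E UNIV ?C}"] conjI) (assumption | force simp: PiE_iff)+
  qed
  moreover have "separable_space ?X"
  \<comment> \<open>The detour is taken because separability itself need not pass to subspaces,
    whereas traces of a countable base form a countable base.\<close>
  proof (rule second_countable_imp_separable_space)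
    obtain \<B> :: "('i \<Rightarrow> nat) set set" where B: "countable \<B>" "topological_basis \<B>"
      using ex_countable_basis by blast
    have "\<exists>V\<in>(\<lambda>U. r -` U \<inter> A) ` \<B>. x \<in> V \<and> V \<subseteq> W" if W: "openin ?X W" "x \<in> W" for W x
    proof -
      obtain U where U: "open U" "W = r -` U \<inter> A"
        using W(1) by (auto simp: openin_pullback_topology)
      then have "r x \<in> U"
        using W(2) by simp
      from topological_basisE[OF B(2) U(1) this]
      obtain B' where "B' \<in> \<B>" "r x \<in> B'" "B' \<subseteq> U" .
      then show ?thesis
        using U(2) W(2) by (intro bexI[of _ "r -` B' \<inter> A"]) auto
    qed
    moreover have "\<forall>V\<in>(\<lambda>U. r -` U \<inter> A) ` \<B>. openin ?X V"
      using topological_basis_open[OF B(2)] by (auto simp: openin_pullback_topology)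
    ultimately show "second_countable ?X"
      unfolding second_countable_def using B(1)
      by (intro exI[of _ "(\<lambda>U. r -` U \<inter> A) ` \<B>"]) auto
  qed
  moreover have "metrizable_space ?X"
  proof -
    have "homeomorphic_map ?X (top_of_set (r ` A)) r"
    proof (rule bijective_open_imp_homeomorphic_map)
      show "continuous_map ?X (top_of_set (r ` A)) r"
        unfolding continuous_map_def
      proof (intro conjI allI impI)
        fix U assume "openin (top_of_set (r ` A)) U"
        then obtain T where T: "open T" "U = r ` A \<inter> T"
          by (auto simp: openin_open)
        then have "{x \<in> topspace ?X. r x \<in> U} = {a \<in> A. r a \<in> T}"
          by (auto simp: top)
        then show "openin ?X {x \<in> topspace ?X. r x \<in> U}"
          using open_r[OF T(1)] by simp
      qed (auto simp: top)
      show "open_map ?X (top_of_set (r ` A)) r"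
        unfolding open_map_def
      proof (intro allI impI)
        fix W assume "openin ?X W"
        then obtain U where U: "open U" "W = r -` U \<inter> A"
          by (auto simp: openin_pullback_topology)
        then have "r ` W = r ` A \<inter> U" by auto
        then show "openin (top_of_set (r ` A)) (r ` W)"
          using U(1) by auto
      qed
    qed (use inj in \<open>auto simp: top\<close>)
    then have "?X homeomorphic_space top_of_set (r ` A)"
      by (rule homeomorphic_map_imp_homeomorphic_space)
    moreover have "(euclidean :: nat topology) = discrete_topology UNIV"
      by (simp add: topology_eq open_discrete)
    then have "metrizable_space (product_topology (\<lambda>i :: 'i. euclidean :: nat topology) UNIV)"
      by (simp add: metrizable_space_product_topology)
    then have "metrizable_space (top_of_set (r ` A))"
      by (simp add: euclidean_product_topology metrizable_space_subtopology)
    ultimately show ?thesis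
      using homeomorphic_metrizable_space by blast
  qed
  ultimately show ?thesis
    using inf by (simp add: set_of_reals_def top)
qed

section \<open>The counterexample of size \<open>\<bb>\<close>\<close>

text \<open>Arrays are coded by the set of positions with value 1, and \<open>j\<close> places these
  codes in the point type. Since \<open>F\<close> is infinite, adding countably many points and
  \<open>F \<times> F\<close> many points does not exceed \<open>|F|\<close>.\<close>

lemma ex_set_of_reals_not_S_fin:
  fixes j :: "(nat \<times> nat) set \<Rightarrow> 'a"
  assumes j: "inj j"
  obtains X :: "'a topology" where "set_of_reals X" "|topspace X| \<le>o \<bb>"
    "\<not> S_fin (gamma_covers X (clopen_sets X)) (tau_covers X (clopen_sets X))"
proof -
  obtain F0 where F0: "unbounded_family F0" "|F0| =o \<bb>"
    using is_least_card_bounding_number by (auto simp: is_least_card_def)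
  obtain F where F: "unbounded_family F" "\<And>f. f \<in> F \<Longrightarrow> mono f" "|F| \<le>o |F0|"
    using unbounded_family_mono[OF F0(1)] by blast
  have infF: "infinite F"
    by (rule infinite_unbounded_family[OF F(1)])
  define P where "P f = {(n, m). f n \<le> m}" for f :: "nat \<Rightarrow> nat"
  define Q where "Q fg = {(n, m). m < fst fg n \<or> snd fg n \<le> m}" for fg :: "(nat \<Rightarrow> nat) \<times> (nat \<Rightarrow> nat)"
  \<comment> \<open>The array that vanishes only at \<open>i\<close> belongs to every
    \<open>V n m\<close> except the one at position \<open>i\<close>; it makes these sets proper and
    pairwise distinct.\<close>
  define C where "C = range (\<lambda>i :: nat \<times> nat. - {i}) \<union> (P ` F \<union> Q ` (F \<times> F))"
  \<comment> \<open>\<open>inv j\<close> recovers the code, so \<open>r\<close> sends a point of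
    \<open>A\<close> to its 0-1 array.\<close>
  define r :: "'a \<Rightarrow> nat \<times> nat \<Rightarrow> nat" where "r a i = of_bool (i \<in> inv j a)" for a i
  define A where "A = j ` C"
  define X where "X = pullback_topology A r euclidean"
  define V where "V n m = j ` {c \<in> C. (n, m) \<in> c}" for n m
  have top: "topspace X = A"
    by (simp add: X_def topspace_pullback_topology)
  have jV: "j c \<in> V n m \<longleftrightarrow> (n, m) \<in> c" if "c \<in> C" for c n m
    using that j by (auto simp: V_def inj_def)
  have VA: "V n m \<subseteq> A" for n m
    by (auto simp: V_def A_def)
  have memC: "- {i} \<in> C" "f \<in> F \<Longrightarrow> P f \<in> C" "f \<in> F \<Longrightarrow> g \<in> F \<Longrightarrow> Q (f, g) \<in> C" for i f g
    by (auto simp: C_def)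
  have injr: "inj_on r A"
  proof (rule inj_onI)
    fix a b assume "a \<in> A" "b \<in> A" and eq: "r a = r b"
    then obtain c d where cd: "a = j c" "b = j d" by (auto simp: A_def)
    have "(i \<in> c) = (i \<in> d)" for i
      using fun_cong[OF eq, of i] by (simp add: r_def cd j of_bool_def split: if_splits)
    then have "c = d" by blast
    then show "a = b" by (simp add: cd)
  qed
  have "inj (\<lambda>i :: nat \<times> nat. - {i})"
    by (auto intro: injI)
  then have "infinite (range (\<lambda>i :: nat \<times> nat. - {i}))"
    using finite_imageD[of "\<lambda>i :: nat \<times> nat. - {i}" UNIV] by (auto simp: finite_prod)
  then have "infinite C" by (auto simp: C_def)
  then have "infinite A"
    using j finite_imageD[of j C] inj_on_subset[OF j] by (auto simp: A_def)
  then have sr: "set_of_reals X"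
    unfolding X_def by (rule set_of_reals_pullback[OF injr])
  have "|range (\<lambda>i :: nat \<times> nat. - {i})| \<le>o |F|"
  proof -
    have "|UNIV :: (nat \<times> nat) set| \<le>o |UNIV :: nat set|"
      using inj_prod_encode by (intro card_of_ordLeqI[of prod_encode]) auto
    also have "|UNIV :: nat set| \<le>o |F|"
      using infF by (simp add: infinite_iff_card_of_nat)
    finally show ?thesis
      by (rule ordLeq_transitive[OF card_of_image])
  qed
  moreover have "|P ` F| \<le>o |F|"
    by (rule card_of_image)
  moreover have "|Q ` (F \<times> F)| \<le>o |F|"
    by (rule ordLeq_ordIso_trans[OF card_of_image card_of_Times_same_infinite[OF infF]])
  ultimately have "|C| \<le>o |F|"
    unfolding C_def using infF by (intro card_of_Un_ordLeq_infinite_Field) (auto simp: card_of_card_order_on Field_card_of)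
  then have "|A| \<le>o |F|"
    unfolding A_def by (rule ordLeq_transitive[OF card_of_image])
  then have card: "|topspace X| \<le>o \<bb>"
    unfolding top by (rule ordLeq_transitive[OF _ ordLeq_ordIso_trans[OF F(3) F0(2)]])
  have clopen: "V n m \<in> clopen_sets X" for n m
  proof -
    have coord: "open ((\<lambda>y :: nat \<times> nat \<Rightarrow> nat. y (n, m)) -` {k})" for k
      by (rule open_vimage) (auto intro: continuous_on_product_coordinates simp: open_discrete)
    have pre: "openin X (r -` U \<inter> A)" if "open U" for U
      unfolding X_def openin_pullback_topology using that by auto
    \<comment> \<open>On \<open>A\<close> the coordinate at \<open>(n, m)\<close> is 0 or 1, so the
      set and its complement are both preimages of open sets.\<close>
    have "V n m = r -` ((\<lambda>y. y (n, m)) -` {1}) \<inter> A"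
      "A - V n m = r -` ((\<lambda>y. y (n, m)) -` {0}) \<inter> A"
      using j by (auto simp: V_def A_def r_def inj_eq of_bool_def split: if_splits)
    then have "openin X (V n m)" "openin X (A - V n m)"
      using pre[OF coord[of 1]] pre[OF coord[of 0]] by (simp_all only:)
    then show ?thesis
      using VA by (simp add: clopen_sets_def closedin_def top)
  qed
  have "\<not> S_fin (gamma_covers X (clopen_sets X)) (tau_covers X (clopen_sets X))"
  proof (rule not_S_fin_array[OF F(1,2), where V = V and p = "\<lambda>f. j (P f)" and q = "\<lambda>f g. j (Q (f, g))"])
    show "V n m \<in> clopen_sets X" for n m
      by (rule clopen)
    show "V n m \<subset> topspace X" for n m
    proof -
      have "j (- {(n, m)}) \<in> A - V n m"
        using memC(1)[of "(n, m)"] jV[OF memC(1)[of "(n, m)"], of n m] by (simp add: A_def)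
      then show ?thesis
        using VA[of n m] top by blast
    qed
    show "n = n' \<and> m = m'" if "V n m = V n' m'" for n m n' m'
    proof -
      have "j (- {(n, m)}) \<notin> V n' m'"
        using jV[OF memC(1)[of "(n, m)"], of n m] that by simp
      then show ?thesis
        using jV[OF memC(1)[of "(n, m)"], of n' m'] by simp
    qed
    show "finite {m. x \<notin> V n m}" if x: "x \<in> topspace X" for x n
    proof -
      obtain c where c: "c \<in> C" "x = j c"
        using x by (auto simp: top A_def)
      \<comment> \<open>Each row is eventually 1: past the deleted position, past \<open>f n\<close>
        for \<open>P f\<close>, and past \<open>g n\<close> for \<open>Q (f, g)\<close>.\<close>
      have "\<exists>N. \<forall>m\<ge>N. (n, m) \<in> c"
        using c(1) unfolding C_def
      proof (elim UnE imageE)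
        fix i assume "c = - {i :: nat \<times> nat}"
        then show ?thesis by (intro exI[of _ "Suc (snd i)"]) auto
      qed (auto simp: P_def Q_def)
      then obtain N where "\<forall>m\<ge>N. (n, m) \<in> c" by blast
      then have "{m. (n, m) \<notin> c} \<subseteq> {..<N}"
        by (auto simp: not_le[symmetric])
      then show ?thesis
        using finite_subset unfolding c(2) jV[OF c(1)] by blast
    qed
    show "j (P f) \<in> topspace X \<and> (\<forall>n m. j (P f) \<in> V n m \<longleftrightarrow> f n \<le> m)" if "f \<in> F" for f
      using memC(2)[OF that] jV[OF memC(2)[OF that]] by (simp add: top A_def P_def)
    show "j (Q (f, g)) \<in> topspace X \<and> (\<forall>n m. j (Q (f, g)) \<in> V n m \<longleftrightarrow> m < f n \<or> g n \<le> m)"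
      if "f \<in> F" "g \<in> F" for f g
      using memC(3)[OF that] jV[OF memC(3)[OF that]] by (simp add: top A_def Q_def)
  qed
  then show ?thesis
    using that sr card by blast
qed

section \<open>Transfer between clopen, open and Borel covers\<close>

text \<open>Selected sets are members of the given covers, so they stay in the smaller class. Read
  contrapositively, failure for clopen covers passes to open and Borel covers.\<close>

lemma S_fin_subset_class:
  assumes "S_fin (gamma_covers X \<T>) (tau_covers X \<T>)" "\<S> \<subseteq> \<T>"
  shows "S_fin (gamma_covers X \<S>) (tau_covers X \<S>)"
  unfolding S_fin_def
proof (intro allI impI)
  fix \<U> :: "nat \<Rightarrow> 'a set set" assume U: "\<forall>n. \<U> n \<in> gamma_covers X \<S>"
  then have "\<forall>n. \<U> n \<in> gamma_covers X \<T>"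
    using assms(2) by (auto simp: gamma_covers_def)
  then obtain \<F> where F: "\<forall>n. finite (\<F> n) \<and> \<F> n \<subseteq> \<U> n" "(\<Union>n. \<F> n) \<in> tau_covers X \<T>"
    using assms(1) unfolding S_fin_def by metis
  moreover have "(\<Union>n. \<F> n) \<subseteq> \<S>"
    using U F(1) unfolding gamma_covers_def by blast
  ultimately show "\<exists>\<F>. (\<forall>n. finite (\<F> n) \<and> \<F> n \<subseteq> \<U> n) \<and> (\<Union>n. \<F> n) \<in> tau_covers X \<S>"
    unfolding tau_covers_def by blast
qed

theorem theorem2p4:
  fixes e :: "real \<Rightarrow> 'a"
  assumes "inj e"
  shows "non_eq (\<lambda>X :: 'a topology.
           S_fin (gamma_covers X (borel_sets X)) (tau_covers X (borel_sets X))) \<bb> \<and>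
         non_eq (\<lambda>X :: 'a topology.
           S_fin (gamma_covers X (open_sets X)) (tau_covers X (open_sets X))) \<bb> \<and>
         non_eq (\<lambda>X :: 'a topology.
           S_fin (gamma_covers X (clopen_sets X)) (tau_covers X (clopen_sets X))) \<bb>"
proof -
  \<comment> \<open>The reals contain a copy of the power set of the naturals; pairing then provides
    the injection of array codes into \<open>'a\<close>.\<close>
  obtain b :: "nat set \<Rightarrow> real" where b: "inj b"
    using nat_sets_eqpoll_reals by (auto simp: eqpoll_def bij_betw_def)
  have "inj (image (prod_encode :: nat \<times> nat \<Rightarrow> nat))"
    using inj_image_eq_iff[OF inj_prod_encode] by (auto intro: injI)
  then have "inj (e \<circ> b \<circ> image prod_encode)"
    by (intro inj_compose assms b)
  then obtain X :: "'a topology" where X: "set_of_reals X" "|topspace X| \<le>o \<bb>"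
    "\<not> S_fin (gamma_covers X (clopen_sets X)) (tau_covers X (clopen_sets X))"
    using ex_set_of_reals_not_S_fin by blast
  \<comment> \<open>One space \<open>X\<close> attains the minimum for every class that contains its
    clopen sets, and the lower bound holds for all classes.\<close>
  have "non_eq (\<lambda>X :: 'a topology. S_fin (gamma_covers X (\<S> X)) (tau_covers X (\<S> X))) \<bb>"
    if "clopen_sets X \<subseteq> \<S> X" for \<S> :: "'a topology \<Rightarrow> 'a set set"
  proof -
    have not: "\<not> S_fin (gamma_covers X (\<S> X)) (tau_covers X (\<S> X))"
      using X(3) S_fin_subset_class that by blast
    then have "|topspace X| =o \<bb>"
      using bounding_number_le_if_not_S_fin X(2) ordIso_iff_ordLeq by blast
    then show ?thesis
      using X(1) not bounding_number_le_if_not_S_fin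
      unfolding non_eq_def is_least_card_def by blast
  qed
  moreover have "clopen_sets X \<subseteq> open_sets X" "open_sets X \<subseteq> borel_sets X"
    by (auto simp: clopen_sets_def open_sets_def borel_sets_def)
  ultimately show ?thesis
    by blast
qed

end
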